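(* Let $K_0,\ldots,K_n\subseteq X$ be non-empty closed convex sets, and let $\gamma_1,\ldots,\gamma_n$ be gauges on $X$. A point $\bar{x}\in K_0$ is a minimizer of the function $f:X\to\mathbb{R}\cup\{+\infty\}$, $f(x)=\sum_{i=1}^n\mathrm{dist}_{\gamma_i}(x,K_i)+\delta(x,K_0)$, if and only if there exist functionals $\phi_0\in\mathrm{nor}(\bar{x},K_0)$ and $\phi_i\in X^\ast$ satisfying $\gamma_i^\circ(-\phi_i)\le 1$ and $\mathrm{dist}_{\gamma_i}(\bar{x},K_i)=\inf_{y\in K_i}\langle\phi_i\mid\bar{x}-y\rangle$, $i\in\{1,\ldots,n\}$, such that $\sum_{i=0}^n\phi_i=0$.
   Context: $X$ is a finite-dimensional real vector space. A gauge on $X$ is a function $\gamma:X\to[0,+\infty)$ such that $\gamma(x)=0$ implies $x=0$; $\gamma(\lambda x)=\lambda\gamma(x)$ for all $x\in X$, $\lambda\ge 0$; and $\gamma(x+y)\le\gamma(x)+\gamma(y)$ for all $x,y\in X$ (no symmetry is assumed). $X^\ast$ is the space of linear functionals on $X$, and $\langle\phi\mid x\rangle$ denotes $\phi(x)$. The polar function of $\gamma$ is $\gamma^\circ:X^\ast\to[0,+\infty)$, $\gamma^\circ(\phi)=\inf\{\lambda>0:\langle\phi\mid x\rangle\le\lambda\gamma(x)\text{ for all }x\in X\}$. The distance function of $K\subseteq X$ with respect to $\gamma$ is $\mathrm{dist}_\gamma(x,K)=\inf\{\gamma(y-x):y\in K\}$. The indicator function is $\delta(x,K)=0$ if $x\in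 K$ and $\delta(x,K)=+\infty$ otherwise. For $x\in K$, the normal cone is $\mathrm{nor}(x,K)=\{\phi\in X^\ast:\langle\phi\mid y-x\rangle\le 0\text{ for all }y\in K\}$. *)

theory Defs
  imports "HOL-Analysis.Analysis"
begin

(* Asymmetric norms; unrelated to the constant gauge of Henstock-Kurzweil integration. *)
definition is_gauge :: "('a::real_vector \<Rightarrow> real) \<Rightarrow> bool" where
  "is_gauge \<gamma> \<longleftrightarrow>
     (\<forall>x. 0 \<le> \<gamma> x) \<and>
     (\<forall>x. \<gamma> x = 0 \<longrightarrow> x = 0) \<and>
     (\<forall>x c. 0 \<le> c \<longrightarrow> \<gamma> (c *\<^sub>R x) = c * \<gamma> x) \<and>
     (\<forall>x y. \<gamma> (x + y) \<le> \<gamma> x + \<gamma> y)"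

(* Meant for linear \<phi>: if \<gamma> is a gauge on a finite-dimensional space, the set of admissible
   factors is then non-empty, so the real infimum is a genuine one. *)
definition polar_gauge :: "('a::real_vector \<Rightarrow> real) \<Rightarrow> ('a \<Rightarrow> real) \<Rightarrow> real" where
  "polar_gauge \<gamma> \<phi> = Inf {c. 0 < c \<and> (\<forall>x. \<phi> x \<le> c * \<gamma> x)}"

definition gauge_dist :: "('a::real_vector \<Rightarrow> real) \<Rightarrow> 'a \<Rightarrow> 'a set \<Rightarrow> real" where
  "gauge_dist \<gamma> x K = (INF y\<in>K. \<gamma> (y - x))"

definition convex_indicator :: "'a \<Rightarrow> 'a set \<Rightarrow> ereal" where
  "convex_indicator x K = (if x \<in> K then 0 else \<infinity>)"

definition normal_cone :: "'a::real_vector \<Rightarrow> 'a set \<Rightarrow> ('a \<Rightarrow> real) set" where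
  "normal_cone x K = {\<phi>. linear \<phi> \<and> (\<forall>y\<in>K. \<phi> (y - x) \<le> 0)}"

definition dist_sum_objective ::
    "nat \<Rightarrow> (nat \<Rightarrow> 'a::real_vector \<Rightarrow> real) \<Rightarrow> (nat \<Rightarrow> 'a set) \<Rightarrow> 'a \<Rightarrow> ereal" where
  "dist_sum_objective n \<gamma> K x =
     ereal (\<Sum>i=1..n. gauge_dist (\<gamma> i) x (K i)) + convex_indicator x (K 0)"

end

theory Submission imports Defs begin

text \<open>
  The condition is the decomposition, at \<open>xbar\<close>, of a zero subgradient of the objective into
  subgradients of its summands. It rests on two facts.

  First, the two requirements on \<open>\<phi> i\<close> say exactly that \<open>\<phi> i\<close> is a subgradient of the distance
  function of \<open>K i\<close> at \<open>xbar\<close> (\<open>subgradient_gauge_dist_iff\<close>): the distance function is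
  \<open>\<gamma> i\<close>-Lipschitz, which bounds \<open>- \<phi> i\<close> by \<open>\<gamma> i\<close>, and it vanishes on \<open>K i\<close>, which bounds
  \<open>\<phi> i (xbar - y)\<close> from below. The bound by \<open>\<gamma> i\<close> is the same as a bound on the polar
  function (\<open>polar_gauge_le_1_iff\<close>); this is where the topology of a finite-dimensional space
  enters, because every linear functional has to be dominated by some multiple of the gauge.

  Secondly, a minimizer over a convex set of a sum of finite convex functions admits one
  subgradient per summand such that their sum is nonnegative in all feasible directions
  (\<open>convex_sum_subgradients\<close>). The summands are split off one by one with the sandwich theorem
  \<open>convex_sandwich\<close>, which in turn is the Hahn-Banach theorem applied to a single sublinear
  functional. The negative of the resulting sum is the normal \<open>\<phi> 0\<close>. Conversely, adding the
  subgradient inequalities and the inequality for the normal shows that \<open>xbar\<close> is optimal.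
\<close>

section \<open>Sublinear functionals and the Hahn-Banach theorem\<close>

definition sublinear :: "('a::real_vector \<Rightarrow> real) \<Rightarrow> bool" where
  "sublinear p \<longleftrightarrow> (\<forall>x y. p (x + y) \<le> p x + p y) \<and> (\<forall>c x. 0 \<le> c \<longrightarrow> p (c *\<^sub>R x) = c * p x)"

lemma sublinear_add: "sublinear p \<Longrightarrow> p (x + y) \<le> p x + p y"
  by (simp add: sublinear_def)

lemma sublinear_scale: "sublinear p \<Longrightarrow> 0 \<le> c \<Longrightarrow> p (c *\<^sub>R x) = c * p x"
  by (simp add: sublinear_def)

lemma sublinear_zero: "sublinear p \<Longrightarrow> p 0 = 0"
  using sublinear_scale[of p 0 0] by simp

lemma sublinear_minus: "sublinear p \<Longrightarrow> 0 \<le> p x + p (- x)"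
  using sublinear_add[of p x "- x"] by (simp add: sublinear_zero)

text \<open>
  Infima of families that are sublinear only as a whole: every inequality may be paid for by
  passing to another index. Homogeneity is needed in one direction only, as the
  reverse inequality follows by rescaling with the inverse factor.
\<close>
lemma sublinear_INF:
  fixes F :: "'i \<Rightarrow> 'a::real_vector \<Rightarrow> real"
  assumes lower: "\<And>x i. i \<in> I \<Longrightarrow> L x \<le> F i x"
    and zero: "L 0 = 0" "i0 \<in> I" "F i0 0 \<le> 0"
    and add: "\<And>i j x y. i \<in> I \<Longrightarrow> j \<in> I \<Longrightarrow> \<exists>k\<in>I. F k (x + y) \<le> F i x + F j y"
    and scale: "\<And>i c x. i \<in> I \<Longrightarrow> 0 < c \<Longrightarrow> \<exists>k\<in>I. F k (c *\<^sub>R x) \<le> c * F i x"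
  shows "sublinear (\<lambda>x. INF i\<in>I. F i x)"
proof -
  define p where "p x = (INF i\<in>I. F i x)" for x
  have ne: "I \<noteq> {}" using zero by blast
  have bdd: "bdd_below ((\<lambda>i. F i x) ` I)" for x
    using lower by (auto intro!: bdd_belowI2[where m = "L x"])
  have le: "p x \<le> F i x" if "i \<in> I" for i x
    unfolding p_def using bdd that by (rule cINF_lower)
  have ge: "m \<le> p x" if "\<And>i. i \<in> I \<Longrightarrow> m \<le> F i x" for m x
    unfolding p_def using ne that by (rule cINF_greatest)
  have p0: "p 0 = 0"
    using le[OF zero(2), of 0] zero(3) ge[of 0 0] lower[of _ 0] zero(1) by force
  have sub: "p (x + y) \<le> p x + p y" for x y
  proof -
    have "p (x + y) - F j y \<le> p x" if j: "j \<in> I" for j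
    proof (rule ge)
      fix i assume "i \<in> I"
      then obtain k where "k \<in> I" "F k (x + y) \<le> F i x + F j y" using add j by blast
      with le[of k "x + y"] show "p (x + y) - F j y \<le> F i x" by linarith
    qed
    then have "p (x + y) - p x \<le> p y" by (intro ge) (simp add: algebra_simps)
    then show ?thesis by simp
  qed
  have half: "p (c *\<^sub>R x) \<le> c * p x" if c: "0 < c" for c x
  proof -
    have "p (c *\<^sub>R x) / c \<le> p x"
    proof (rule ge)
      fix i assume "i \<in> I"
      then obtain k where "k \<in> I" "F k (c *\<^sub>R x) \<le> c * F i x" using scale c by blast
      with le[of k "c *\<^sub>R x"] c show "p (c *\<^sub>R x) / c \<le> F i x"
        by (simp add: field_simps)
    qed
    with c show ?thesis by (simp add: field_simps)
  qed
  have "p (c *\<^sub>R x) = c * p x" if c: "0 \<le> c" for c x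
  proof (cases "c = 0")
    case True then show ?thesis by (simp add: p0)
  next
    case False
    with c have "0 < c" by simp
    then have "c * p x \<le> p (c *\<^sub>R x)"
      using half[of "inverse c" "c *\<^sub>R x"] by (simp add: field_simps)
    with half[OF \<open>0 < c\<close>] show ?thesis by (intro antisym)
  qed
  with sub show ?thesis by (simp add: sublinear_def flip: p_def)
qed

text \<open>
  A sublinear functional is linear on a line exactly if it is odd there. Replacing \<open>p x\<close> by the
  infimum of \<open>p (x + t *\<^sub>R y) - t * p y\<close> over \<open>t \<ge> 0\<close> lowers the value at \<open>- y\<close> to \<open>- p y\<close>, the least
  value that subadditivity permits.
\<close>
lemma sublinear_minorant_odd_at:
  fixes p :: "'a::real_vector \<Rightarrow> real"
  assumes p: "sublinear p"
  shows "\<exists>q. sublinear q \<and> (\<forall>x. q x \<le> p x) \<and> q y + q (- y) = 0"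
proof -
  define F where "F t x = p (x + t *\<^sub>R y) - t * p y" for t x
  define q where "q x = (INF t\<in>{0..}. F t x)" for x
  have lower: "- p (- x) \<le> F t x" if "t \<in> {0..}" for t x
    using sublinear_add[OF p, of "x + t *\<^sub>R y" "- x"] sublinear_scale[OF p, of t y] that
    by (simp add: F_def)
  have q: "sublinear q"
    unfolding q_def
  proof (rule sublinear_INF[where L = "\<lambda>x. - p (- x)" and ?i0.0 = 0])
    show "- p (- x) \<le> F t x" if "t \<in> {0..}" for t x using lower that .
    show "- p (- 0) = 0" "(0::real) \<in> {0..}" "F 0 0 \<le> 0"
      by (simp_all add: sublinear_zero p F_def)
    show "\<exists>u\<in>{0..}. F u (x + z) \<le> F s x + F t z" if "s \<in> {0..}" "t \<in> {0..}" for s t x z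
      using that sublinear_add[OF p, of "x + s *\<^sub>R y" "z + t *\<^sub>R y"]
      by (intro bexI[of _ "s + t"]) (auto simp: F_def algebra_simps)
    show "\<exists>u\<in>{0..}. F u (c *\<^sub>R x) \<le> c * F t x" if "t \<in> {0..}" "0 < c" for t c x
      using that sublinear_scale[OF p, of c "x + t *\<^sub>R y"]
      by (intro bexI[of _ "c * t"]) (auto simp: F_def algebra_simps)
  qed
  have le: "q x \<le> F t x" if "0 \<le> t" for t x
    unfolding q_def using lower that
    by (intro cINF_lower bdd_belowI2[where m = "- p (- x)"]) auto
  have qp: "q x \<le> p x" for x using le[of 0 x] by (simp add: F_def)
  have "q (- y) \<le> - p y" using le[of 1 "- y"] by (simp add: F_def sublinear_zero p)
  with qp[of y] sublinear_minus[OF q, of y] have "q y + q (- y) = 0" by linarith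
  with q qp show ?thesis by blast
qed

lemma sublinear_odd_subspace:
  assumes q: "sublinear q"
  shows "subspace {x. q x + q (- x) = 0}"
proof (rule subspaceI)
  show "0 \<in> {x. q x + q (- x) = 0}" by (simp add: sublinear_zero q)
next
  fix x y assume "x \<in> {x. q x + q (- x) = 0}" "y \<in> {x. q x + q (- x) = 0}"
  then show "x + y \<in> {x. q x + q (- x) = 0}"
    using sublinear_add[OF q, of x y] sublinear_add[OF q, of "- x" "- y"]
      sublinear_minus[OF q, of "x + y"] by simp
next
  fix c x assume x: "x \<in> {x. q x + q (- x) = 0}"
  have "q (c *\<^sub>R x) + q (- (c *\<^sub>R x)) = \<bar>c\<bar> * (q x + q (- x))"
    using sublinear_scale[OF q, of "\<bar>c\<bar>" x] sublinear_scale[OF q, of "\<bar>c\<bar>" "- x"]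
    by (cases "0 \<le> c") (simp_all add: algebra_simps)
  with x show "c *\<^sub>R x \<in> {x. q x + q (- x) = 0}" by simp
qed

lemma sublinear_odd_imp_linear:
  assumes q: "sublinear q" and odd: "\<And>x. q x + q (- x) = 0"
  shows "linear q"
proof (rule linearI)
  fix x y
  show "q (x + y) = q x + q y"
    using sublinear_add[OF q, of x y] sublinear_add[OF q, of "- x" "- y"] 
      odd[of x] odd[of y] odd[of "x + y"] by simp
next
  fix c x
  show "q (c *\<^sub>R x) = c *\<^sub>R q x"
    using sublinear_scale[OF q, of "\<bar>c\<bar>" x] odd[of "c *\<^sub>R x"]
    by (cases "0 \<le> c") simp_all
qed

text \<open>
  Oddness is enforced at one spanning vector after the other. It is not lost in later steps,
  since a sublinear minorant \<open>r\<close> of a functional that is odd at \<open>a\<close> satisfies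
  \<open>0 \<le> r a + r (- a) \<le> 0\<close>. As the vectors at which a sublinear functional is odd form a
  subspace, finitely many steps suffice.
\<close>
lemma hahn_banach_finite_dimensional:
  fixes B :: "'a::real_vector set" and p :: "'a \<Rightarrow> real"
  assumes B: "finite B" "span B = UNIV" and p: "sublinear p"
  shows "\<exists>\<phi>. linear \<phi> \<and> (\<forall>x. \<phi> x \<le> p x)"
proof -
  have "\<exists>q. sublinear q \<and> (\<forall>x. q x \<le> p x) \<and> (\<forall>b\<in>B. q b + q (- b) = 0)"
    using B(1)
  proof induction
    case empty
    then show ?case using p by auto
  next
    case (insert b A)
    then obtain q where q: "sublinear q" "\<forall>x. q x \<le> p x" "\<forall>a\<in>A. q a + q (- a) = 0" by blast
    obtain r where r: "sublinear r" "\<forall>x. r x \<le> q x" "r b + r (- b) = 0"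
      using sublinear_minorant_odd_at[OF q(1)] by blast
    have "r a + r (- a) = 0" if "a \<in> A" for a
      using that q(3) r(2)[rule_format, of a] r(2)[rule_format, of "- a"]
        sublinear_minus[OF r(1), of a] by fastforce
    with q(2) r show ?case by (intro exI[of _ r]) (auto intro: order_trans)
  qed
  then obtain q where q: "sublinear q" "\<forall>x. q x \<le> p x" "\<forall>b\<in>B. q b + q (- b) = 0" by blast
  have "span B \<subseteq> {x. q x + q (- x) = 0}"
    using q by (intro span_minimal sublinear_odd_subspace) auto
  with B(2) have "linear q" by (intro sublinear_odd_imp_linear q) auto
  with q show ?thesis by blast
qed

section \<open>Subgradients of a sum of convex functions\<close>

text \<open>
  A linear \<open>\<phi>\<close> with \<open>\<phi> \<le> f\<close> and \<open>- h \<le> \<phi>\<close> on \<open>K\<close> satisfies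
  \<open>t * \<phi> d = \<phi> (x + t *\<^sub>R d) - \<phi> x \<le> f (x + t *\<^sub>R d) + h x\<close> for all \<open>x \<in> K\<close> and \<open>t > 0\<close>. The least
  bound on \<open>\<phi> d\<close> that arises in this way is a sublinear function of \<open>d\<close>, and every linear
  minorant of it separates \<open>f\<close> and \<open>- h\<close>.
\<close>
lemma convex_sandwich_at_zero:
  fixes B :: "'a::real_vector set" and f h :: "'a::real_vector \<Rightarrow> real"
  assumes B: "finite B" "span B = UNIV"
    and f: "convex_on UNIV f" "f 0 = 0"
    and h: "convex_on K h" "0 \<in> K" "h 0 = 0"
    and nonneg: "\<And>x. x \<in> K \<Longrightarrow> 0 \<le> f x + h x"
  shows "\<exists>\<phi>. linear \<phi> \<and> (\<forall>x. \<phi> x \<le> f x) \<and> (\<forall>x\<in>K. 0 \<le> \<phi> x + h x)"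
proof -
  define I :: "(real \<times> 'a) set" where "I = {0<..} \<times> K"
  define F where "F = (\<lambda>(t, x) d. (f (x + t *\<^sub>R d) + h x) / t)"
  have K: "convex K" using h(1) by (rule convex_on_imp_convex)
  have fc: "f (a *\<^sub>R x + b *\<^sub>R y) \<le> a * f x + b * f y"
    if "0 \<le> a" "0 \<le> b" "a + b = 1" for a b x y
    using f(1) that by (auto simp: convex_on_def)
  have hc: "h (a *\<^sub>R x + b *\<^sub>R y) \<le> a * h x + b * h y"
    if "0 \<le> a" "0 \<le> b" "a + b = 1" "x \<in> K" "y \<in> K" for a b x y
    using h(1) that by (auto simp: convex_on_def)
  have lower: "- f (- d) \<le> F i d" if "i \<in> I" for i d
  proof -
    obtain t x where i: "i = (t, x)" "0 < t" "x \<in> K" using \<open>i \<in> I\<close> by (auto simp: I_def)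
    \<comment> \<open>With this weight the convex combination of \<open>x + t *\<^sub>R d\<close> and \<open>- d\<close> lies
      between \<open>0\<close> and \<open>x\<close>, hence in \<open>K\<close>.\<close>
    define a where "a = 1 / (1 + t)"
    have a: "0 < a" "a < 1" "a * t = 1 - a" using i(2) by (auto simp: a_def field_simps)
    have "a *\<^sub>R x = a *\<^sub>R (x + t *\<^sub>R d) + (1 - a) *\<^sub>R (- d)"
      by (simp add: scaleR_add_right a(3))
    then have 1: "f (a *\<^sub>R x) \<le> a * f (x + t *\<^sub>R d) + (1 - a) * f (- d)"
      using fc[of a "1 - a" "x + t *\<^sub>R d" "- d"] a by simp
    have 2: "h (a *\<^sub>R x) \<le> a * h x"
      using hc[of a "1 - a" x 0] a i h by simp
    have "a *\<^sub>R x \<in> K"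
      using convexD[OF K i(3) h(2), of a "1 - a"] a by simp
    from nonneg[OF this] 1 2 have "0 \<le> a * (f (x + t *\<^sub>R d) + h x) + a * t * f (- d)"
      by (simp add: a(3) algebra_simps)
    also have "\<dots> = a * (f (x + t *\<^sub>R d) + h x + t * f (- d))" by (simp add: algebra_simps)
    finally have "0 \<le> f (x + t *\<^sub>R d) + h x + t * f (- d)"
      using a(1) by (simp add: zero_le_mult_iff)
    with i show ?thesis by (simp add: F_def field_simps)
  qed
  define p where "p d = (INF i\<in>I. F i d)" for d
  have "sublinear p"
    unfolding p_def
  proof (rule sublinear_INF[where L = "\<lambda>d. - f (- d)" and ?i0.0 = "(1, 0)"])
    show "- f (- d) \<le> F i d" if "i \<in> I" for i d using lower that .
    show "- f (- 0) = 0" "(1, 0) \<in> I" "F (1, 0) 0 \<le> 0"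
      using f h by (simp_all add: I_def F_def)
  next
    fix i j d e assume "i \<in> I" "j \<in> I"
    then obtain t x s y where ij: "i = (t, x)" "0 < t" "x \<in> K" "j = (s, y)" "0 < s" "y \<in> K"
      by (auto simp: I_def)
    \<comment> \<open>The step \<open>u\<close> with \<open>1 / u = 1 / t + 1 / s\<close> makes the convex combination of
      \<open>x + t *\<^sub>R d\<close> and \<open>y + s *\<^sub>R e\<close> a step from \<open>z\<close> in direction \<open>d + e\<close>, and turns the weights \<open>a\<close>, \<open>b\<close>
      into \<open>1 / t\<close>, \<open>1 / s\<close> after division by \<open>u\<close>.\<close>
    define u where "u = t * s / (t + s)"
    define a where "a = s / (t + s)"
    define b where "b = t / (t + s)"
    define z where "z = a *\<^sub>R x + b *\<^sub>R y"
    have ab: "0 \<le> a" "0 \<le> b" "a + b = 1" "0 < u" "a * t = u" "b * s = u"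
      using ij by (auto simp: a_def b_def u_def add_divide_distrib[symmetric])
    have ne: "a / u = 1 / t" "b / u = 1 / s"
      using ij ab by (auto simp: field_simps)
    have z: "z \<in> K" unfolding z_def using convexD[OF K] ij ab by blast
    have "z + u *\<^sub>R (d + e) = a *\<^sub>R (x + t *\<^sub>R d) + b *\<^sub>R (y + s *\<^sub>R e)"
      by (simp add: z_def scaleR_add_right ab)
    then have "f (z + u *\<^sub>R (d + e)) \<le> a * f (x + t *\<^sub>R d) + b * f (y + s *\<^sub>R e)"
      using fc ab by simp
    moreover have "h z \<le> a * h x + b * h y"
      unfolding z_def using hc ij ab by blast
    ultimately have "f (z + u *\<^sub>R (d + e)) + h z
        \<le> a * (f (x + t *\<^sub>R d) + h x) + b * (f (y + s *\<^sub>R e) + h y)"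
      by (simp add: algebra_simps)
    then have "(f (z + u *\<^sub>R (d + e)) + h z) / u
        \<le> (a * (f (x + t *\<^sub>R d) + h x) + b * (f (y + s *\<^sub>R e) + h y)) / u"
      using ab(4) by (simp add: divide_right_mono)
    also have "\<dots> = a / u * (f (x + t *\<^sub>R d) + h x) + b / u * (f (y + s *\<^sub>R e) + h y)"
      by (simp add: add_divide_distrib)
    finally have "F (u, z) (d + e) \<le> F i d + F j e"
      unfolding ne by (simp add: F_def ij)
    with z ab(4) show "\<exists>k\<in>I. F k (d + e) \<le> F i d + F j e"
      by (intro bexI[of _ "(u, z)"]) (auto simp: I_def)
  next
    fix i c d assume "i \<in> I" "(0::real) < c"
    then obtain t x where i: "i = (t, x)" "0 < t" "x \<in> K" by (auto simp: I_def)
    have "F (t / c, x) (c *\<^sub>R d) = c * F i d"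
      using \<open>0 < c\<close> i by (simp add: F_def)
    with i \<open>0 < c\<close> show "\<exists>k\<in>I. F k (c *\<^sub>R d) \<le> c * F i d"
      by (intro bexI[of _ "(t / c, x)"]) (auto simp: I_def)
  qed
  then obtain \<phi> where \<phi>: "linear \<phi>" "\<And>x. \<phi> x \<le> p x"
    using hahn_banach_finite_dimensional[OF B] by blast
  have bound: "\<phi> d \<le> f (x + d) + h x" if "x \<in> K" for x d
  proof -
    have "p d \<le> F (1, x) d"
      unfolding p_def using lower that
      by (intro cINF_lower bdd_belowI2[where m = "- f (- d)"]) (auto simp: I_def)
    with \<phi>(2)[of d] show ?thesis by (simp add: F_def)
  qed
  \<comment> \<open>The base point \<open>0\<close> gives the bound by \<open>f\<close>, the direction \<open>- x\<close> at base point \<open>x\<close> the bound by \<open>- h\<close>.\<close>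
  have "\<phi> x \<le> f x" for x using bound[of 0 x] h by simp
  moreover have "0 \<le> \<phi> x + h x" if "x \<in> K" for x
    using bound[OF that, of "- x"] linear_neg[OF \<phi>(1)] f by simp
  ultimately show ?thesis using \<phi>(1) by blast
qed

lemma convex_on_translate:
  assumes "convex_on K h"
  shows "convex_on ((\<lambda>x. x - a) ` K) (\<lambda>x. h (a + x) - c)"
proof -
  have eq: "a + (u *\<^sub>R (x - a) + v *\<^sub>R (y - a)) = u *\<^sub>R x + v *\<^sub>R y" if "u + v = 1" for u v x y
  proof -
    have "u *\<^sub>R a + v *\<^sub>R a = a" using that by (simp flip: scaleR_add_left)
    then show ?thesis by (simp add: algebra_simps)
  qed
  have K: "convex K" using assms by (rule convex_on_imp_convex)
  show ?thesis
  proof (rule convex_onI)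
    show "convex ((\<lambda>x. x - a) ` K)"
      using convex_translation[OF K, of "- a"] by simp
    fix t x y assume t: "0 < t" "t < (1::real)" and xy: "x \<in> (\<lambda>x. x - a) ` K" "y \<in> (\<lambda>x. x - a) ` K"
    then obtain x' y' where x': "x = x' - a" "x' \<in> K" "y = y' - a" "y' \<in> K" by auto
    have "h (a + ((1 - t) *\<^sub>R x + t *\<^sub>R y)) \<le> (1 - t) * h x' + t * h y'"
      unfolding x' eq[of "1 - t" t, simplified] using convex_onD[OF assms, of t x' y'] t x' by simp
    then show "h (a + ((1 - t) *\<^sub>R x + t *\<^sub>R y)) - c \<le> (1 - t) * (h (a + x) - c) + t * (h (a + y) - c)"
      by (simp add: x' algebra_simps)
  qed
qed

lemma convex_sandwich:
  fixes B :: "'a::real_vector set" and f h :: "'a::real_vector \<Rightarrow> real"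
  assumes B: "finite B" "span B = UNIV"
    and f: "convex_on UNIV f"
    and h: "convex_on K h" "a \<in> K"
    and min: "\<And>x. x \<in> K \<Longrightarrow> f a + h a \<le> f x + h x"
  shows "\<exists>\<phi>. linear \<phi> \<and> (\<forall>x. f a + \<phi> (x - a) \<le> f x) \<and> (\<forall>x\<in>K. h a \<le> \<phi> (x - a) + h x)"
proof -
  have UN: "(\<lambda>x. x - a) ` UNIV = UNIV" by (auto intro: image_eqI[where x = "_ + a"])
  have "\<exists>\<phi>. linear \<phi> \<and> (\<forall>x. \<phi> x \<le> f (a + x) - f a) \<and>
      (\<forall>x\<in>(\<lambda>x. x - a) ` K. 0 \<le> \<phi> x + (h (a + x) - h a))"
    using convex_on_translate[OF f, of a "f a"] convex_on_translate[OF h(1), of a "h a"] h min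
    by (intro convex_sandwich_at_zero[OF B]) (auto simp: UN algebra_simps)
  then obtain \<phi> where \<phi>: "linear \<phi>" "\<And>x. \<phi> x \<le> f (a + x) - f a"
      "\<And>x. x \<in> K \<Longrightarrow> 0 \<le> \<phi> (x - a) + (h x - h a)" by auto
  have "f a + \<phi> (x - a) \<le> f x" for x using \<phi>(2)[of "x - a"] by simp
  moreover have "h a \<le> \<phi> (x - a) + h x" if "x \<in> K" for x using \<phi>(3)[OF that] by simp
  ultimately show ?thesis using \<phi>(1) by blast
qed

lemma convex_on_linear_shift:
  assumes "linear \<phi>" "convex K"
  shows "convex_on K (\<lambda>x. \<phi> (x - a))"
proof (rule convex_onI)
  fix t x y 
  show "\<phi> ((1 - t) *\<^sub>R x + t *\<^sub>R y - a) \<le> (1 - t) * \<phi> (x - a) + t * \<phi> (y - a)"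
    by (simp add: linear_diff linear_add linear_cmul assms algebra_simps)
qed (fact assms)

text \<open>
  Induction on the index set. A summand that has been split off survives as a linear term, so
  the induction runs over the sum of the remaining functions and an arbitrary linear \<open>\<psi>\<close>.
\<close>
lemma convex_sum_subgradients:
  fixes B :: "'a::real_vector set" and f :: "'i \<Rightarrow> 'a::real_vector \<Rightarrow> real"
  assumes B: "finite B" "span B = UNIV"
    and I: "finite I" and f: "\<And>i. i \<in> I \<Longrightarrow> convex_on UNIV (f i)"
    and K: "convex K" "a \<in> K"
    and min: "\<And>x. x \<in> K \<Longrightarrow> (\<Sum>i\<in>I. f i a) \<le> (\<Sum>i\<in>I. f i x)"
  shows "\<exists>\<phi>. (\<forall>i\<in>I. linear (\<phi> i) \<and> (\<forall>x. f i a + \<phi> i (x - a) \<le> f i x)) \<and>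
      (\<forall>x\<in>K. 0 \<le> (\<Sum>i\<in>I. \<phi> i (x - a)))"
proof -
  have "\<exists>\<phi>. (\<forall>i\<in>I. linear (\<phi> i) \<and> (\<forall>x. f i a + \<phi> i (x - a) \<le> f i x)) \<and>
      (\<forall>x\<in>K. 0 \<le> (\<Sum>i\<in>I. \<phi> i (x - a)) + \<psi> (x - a))"
    if "linear \<psi>" "\<And>x. x \<in> K \<Longrightarrow> (\<Sum>i\<in>I. f i a) \<le> (\<Sum>i\<in>I. f i x) + \<psi> (x - a)" for \<psi>
    using I f that
  proof (induction arbitrary: \<psi>)
    case empty
    then show ?case by simp
  next
    case (insert j J)
    let ?h = "\<lambda>x. (\<Sum>i\<in>J. f i x) + \<psi> (x - a)"
    have "convex_on K (\<lambda>x. \<Sum>i\<in>J. f i x)"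
      using insert.hyps(1) insert.prems(1)
    proof (induction J)
      case empty
      then show ?case using K by (simp add: convex_on_def)
    next
      case (insert i J)
      then show ?case by (auto intro!: convex_on_add intro: convex_on_subset K)
    qed
    then have h: "convex_on K ?h"
      by (rule convex_on_add) (intro convex_on_linear_shift insert.prems K)
    have "f j a + ?h a \<le> f j x + ?h x" if "x \<in> K" for x
      using insert.prems(3)[OF that] insert.hyps linear_0[OF insert.prems(2)] by simp
    then obtain \<theta> where \<theta>: "linear \<theta>" "\<And>x. f j a + \<theta> (x - a) \<le> f j x"
        "\<And>x. x \<in> K \<Longrightarrow> ?h a \<le> \<theta> (x - a) + ?h x"
      using convex_sandwich[OF B _ h K(2), of "f j"] insert.prems(1) by auto
    have "linear (\<lambda>x. \<theta> x + \<psi> x)"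
      using \<theta>(1) insert.prems(2) by (rule linear_compose_add)
    moreover have "(\<Sum>i\<in>J. f i a) \<le> (\<Sum>i\<in>J. f i x) + (\<theta> (x - a) + \<psi> (x - a))" if "x \<in> K" for x
      using \<theta>(3)[OF that] linear_0[OF insert.prems(2)] by simp
    ultimately have "\<exists>\<phi>. (\<forall>i\<in>J. linear (\<phi> i) \<and> (\<forall>x. f i a + \<phi> i (x - a) \<le> f i x)) \<and>
        (\<forall>x\<in>K. 0 \<le> (\<Sum>i\<in>J. \<phi> i (x - a)) + (\<theta> (x - a) + \<psi> (x - a)))"
      using insert.prems(1) by (intro insert.IH) auto
    then obtain \<phi> where \<phi>: "\<And>i. i \<in> J \<Longrightarrow> linear (\<phi> i) \<and> (\<forall>x. f i a + \<phi> i (x - a) \<le> f i x)"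
        "\<And>x. x \<in> K \<Longrightarrow> 0 \<le> (\<Sum>i\<in>J. \<phi> i (x - a)) + (\<theta> (x - a) + \<psi> (x - a))"
      by blast
    have "(\<Sum>i\<in>J. (\<phi>(j := \<theta>)) i y) = (\<Sum>i\<in>J. \<phi> i y)" for y
      using insert.hyps by (intro sum.cong) auto
    with \<phi> \<theta> insert.hyps show ?case
      by (intro exI[of _ "\<phi>(j := \<theta>)"]) (auto simp: algebra_simps)
  qed
  from this[of "\<lambda>x. 0"] min show ?thesis by (simp add: linear_zero)
qed

section \<open>Gauges dominate linear functionals\<close>

lemma compact_coordinate_box:
  fixes A :: "'a::real_normed_vector set"
  assumes "finite A"
  shows "compact {\<Sum>b\<in>A. u b *\<^sub>R b | u. \<forall>b\<in>A. \<bar>u b\<bar> \<le> (1::real)}"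
  using assms
proof induction
  case empty
  then show ?case by simp
next
  case (insert a A)
  let ?C = "\<lambda>A. {\<Sum>b\<in>A. u b *\<^sub>R b | u. \<forall>b\<in>A. \<bar>u b\<bar> \<le> (1::real)}"
  have "?C (insert a A) = {x + y | x y. x \<in> (\<lambda>t. t *\<^sub>R a) ` {-1..1} \<and> y \<in> ?C A}" (is "?L = ?R")
  proof
    show "?L \<subseteq> ?R" using insert.hyps by (fastforce simp: abs_le_iff)
    show "?R \<subseteq> ?L"
    proof clarify
      fix t u assume tu: "t \<in> {-1..1::real}" "\<forall>b\<in>A. \<bar>u b\<bar> \<le> (1::real)"
      have "(\<Sum>b\<in>A. (u(a := t)) b *\<^sub>R b) = (\<Sum>b\<in>A. u b *\<^sub>R b)"
        using insert.hyps by (intro sum.cong) auto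
      with tu insert.hyps
      show "\<exists>v. t *\<^sub>R a + (\<Sum>b\<in>A. u b *\<^sub>R b) = (\<Sum>b\<in>insert a A. v b *\<^sub>R b) \<and>
          (\<forall>b\<in>insert a A. \<bar>v b\<bar> \<le> 1)"
        by (intro exI[of _ "u(a := t)"]) (auto simp: abs_le_iff)
    qed
  qed
  moreover have "compact ((\<lambda>t. t *\<^sub>R a) ` {-1..1})"
    by (intro compact_continuous_image continuous_intros compact_Icc)
  then have "compact ?R"
    using insert.IH by (rule compact_sums)
  ultimately show ?case by (simp only:)
qed

text \<open>
  The boundary of the unit cube in coordinates is compact and, by independence, avoids the
  origin; so \<open>G\<close> has a positive minimum on it, and homogeneity extends the bound to the whole
  space. The lemma serves twice: with the norm as \<open>G\<close> it gives continuity of gauges, and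
  with a gauge as \<open>G\<close> it gives domination by the gauge.
\<close>
lemma coordinates_le_positive_homogeneous:
  fixes B :: "'a::real_normed_vector set" and G :: "'a \<Rightarrow> real"
  assumes B: "finite B" "independent B"
    and G: "continuous_on UNIV G" "\<And>c x. 0 \<le> c \<Longrightarrow> G (c *\<^sub>R x) = c * G x"
      "\<And>x. x \<noteq> 0 \<Longrightarrow> 0 < G x"
  shows "\<exists>M\<ge>0. \<forall>u. \<forall>b\<in>B. \<bar>u b\<bar> \<le> M * G (\<Sum>b\<in>B. u b *\<^sub>R b)"
proof (cases "B = {}")
  case True
  then show ?thesis by auto
next
  case False
  let ?C = "\<lambda>A. {\<Sum>b\<in>A. u b *\<^sub>R b | u. \<forall>b\<in>A. \<bar>u b\<bar> \<le> (1::real)}"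
  \<comment> \<open>The boundary of the cube, as the union of its faces: one coordinate is \<open>1\<close> or \<open>- 1\<close>.\<close>
  define D where "D = (\<Union>b\<in>B. \<Union>s\<in>{-1, 1::real}. (+) (s *\<^sub>R b) ` ?C (B - {b}))"
  have "compact D"
    unfolding D_def using B(1)
    by (intro compact_UN compact_translation compact_coordinate_box) auto
  have D_I: "(\<Sum>b\<in>B. u b *\<^sub>R b) \<in> D" if "a \<in> B" "\<bar>u a\<bar> = 1" "\<forall>b\<in>B. \<bar>u b\<bar> \<le> 1" for u a
  proof -
    have "(\<Sum>b\<in>B. u b *\<^sub>R b) = u a *\<^sub>R a + (\<Sum>b\<in>B - {a}. u b *\<^sub>R b)"
      using B that by (simp add: sum.remove)
    also have "\<dots> \<in> (+) (u a *\<^sub>R a) ` ?C (B - {a})"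
      using that(3) by (intro imageI) blast
    finally show ?thesis
      unfolding D_def using that(1,2) by (intro UN_I[of a] UN_I[of "u a"]) auto
  qed
  have "0 \<notin> D"
  proof
    assume "0 \<in> D"
    then obtain b s y where bsy: "b \<in> B" "s \<in> {-1, 1::real}" "y \<in> ?C (B - {b})"
        "0 = s *\<^sub>R b + y"
      unfolding D_def by blast
    then obtain u where "y = (\<Sum>b\<in>B - {b}. u b *\<^sub>R b)" by blast
    with bsy have bsu: "b \<in> B" "s \<in> {-1, 1::real}"
        "s *\<^sub>R b + (\<Sum>b\<in>B - {b}. u b *\<^sub>R b) = 0"
      by simp_all
    have "(\<Sum>a\<in>B - {b}. (u(b := s)) a *\<^sub>R a) = (\<Sum>a\<in>B - {b}. u a *\<^sub>R a)"
      by (intro sum.cong) auto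
    with bsu B have "(\<Sum>a\<in>B. (u(b := s)) a *\<^sub>R a) = 0"
      by (simp add: sum.remove)
    from independentD[OF B(2,1) subset_refl this bsu(1)] bsu(2) show False by auto
  qed
  moreover have "D \<noteq> {}" using False D_I[of _ "\<lambda>_. 1"] by auto
  moreover have "continuous_on D G" using G(1) by (rule continuous_on_subset) simp
  ultimately obtain z where z: "z \<in> D" "\<forall>x\<in>D. G z \<le> G x" and "z \<noteq> 0"
    using continuous_attains_inf[OF \<open>compact D\<close>, of G] by blast
  note G_z = G(3)[OF \<open>z \<noteq> 0\<close>]
  have "\<bar>u b\<bar> \<le> 1 / G z * G (\<Sum>b\<in>B. u b *\<^sub>R b)" if "b \<in> B" for u b
  proof -
    define r where "r = Max ((\<lambda>b. \<bar>u b\<bar>) ` B)"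
    have le: "\<bar>u a\<bar> \<le> r" if "a \<in> B" for a using B that by (simp add: r_def)
    have "r \<in> (\<lambda>b. \<bar>u b\<bar>) ` B" unfolding r_def using B False by (intro Max_in) auto
    then obtain a where a: "a \<in> B" "\<bar>u a\<bar> = r" by auto
    show ?thesis
    proof (cases "r = 0")
      case True
      then have "u b = 0" if "b \<in> B" for b using le[OF that] by simp
      with that G(2)[of 0 0] show ?thesis by simp
    next
      case False
      with le[OF a(1)] a have r: "0 < r" by auto
      have "(\<Sum>b\<in>B. (u b / r) *\<^sub>R b) \<in> D"
        using a le r by (intro D_I[of a]) auto
      then have "G z \<le> G (inverse r *\<^sub>R (\<Sum>b\<in>B. u b *\<^sub>R b))"
        using z(2) by (auto simp add: scaleR_sum_right divide_inverse mult.commute)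
      with r have "r * G z \<le> G (\<Sum>b\<in>B. u b *\<^sub>R b)" by (simp add: G(2) field_simps)
      moreover have "\<bar>u b\<bar> * G z \<le> r * G z" using le[OF that] G_z by simp
      ultimately have "\<bar>u b\<bar> * G z \<le> G (\<Sum>b\<in>B. u b *\<^sub>R b)" by linarith
      with G_z show ?thesis by (simp add: field_simps)
    qed
  qed
  then show ?thesis using G_z by (intro exI[of _ "1 / G z"]) auto
qed

lemma positive_homogeneous_dominates_sublinear:
  fixes B :: "'a::real_normed_vector set" and G :: "'a \<Rightarrow> real"
  assumes B: "finite B" "independent B" "span B = UNIV"
    and G: "continuous_on UNIV G" "\<And>c x. 0 \<le> c \<Longrightarrow> G (c *\<^sub>R x) = c * G x"
      "\<And>x. x \<noteq> 0 \<Longrightarrow> 0 < G x"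
    and p: "sublinear p"
  shows "\<exists>C>0. \<forall>x. p x \<le> C * G x"
proof -
  obtain M where M: "0 \<le> M" "\<And>u b. b \<in> B \<Longrightarrow> \<bar>u b\<bar> \<le> M * G (\<Sum>b\<in>B. u b *\<^sub>R b)"
    using coordinates_le_positive_homogeneous[OF B(1,2) G] by blast
  have p_sum: "p (\<Sum>b\<in>A. v b) \<le> (\<Sum>b\<in>A. p (v b))" if "finite A" for A :: "'a set" and v
    using that
  proof induction
    case empty
    then show ?case by (simp add: sublinear_zero p)
  next
    case (insert a A)
    then show ?case using sublinear_add[OF p, of "v a" "\<Sum>b\<in>A. v b"] by simp
  qed
  define N where "N = (\<Sum>b\<in>B. \<bar>p b\<bar> + \<bar>p (- b)\<bar>)"
  have "p x \<le> (M * N + 1) * G x" for x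
  proof -
    have "x \<in> span B" using B by simp
    then obtain u where u: "x = (\<Sum>b\<in>B. u b *\<^sub>R b)"
      using span_finite[OF B(1)] by auto
    have G0: "0 \<le> G x" using G(2)[of 0 0] G(3)[of x] by (cases "x = 0") auto
    have "p (u b *\<^sub>R b) \<le> M * G x * (\<bar>p b\<bar> + \<bar>p (- b)\<bar>)" if "b \<in> B" for b
    proof -
      have "p (u b *\<^sub>R b) \<le> \<bar>u b\<bar> * (\<bar>p b\<bar> + \<bar>p (- b)\<bar>)"
        using sublinear_scale[OF p, of "\<bar>u b\<bar>" b] sublinear_scale[OF p, of "\<bar>u b\<bar>" "- b"]
        by (cases "0 \<le> u b") (auto intro!: mult_left_mono)
      also have "\<dots> \<le> M * G x * (\<bar>p b\<bar> + \<bar>p (- b)\<bar>)"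
        using M(2)[OF that, of u] u by (intro mult_right_mono) auto
      finally show ?thesis .
    qed
    then have "(\<Sum>b\<in>B. p (u b *\<^sub>R b)) \<le> M * G x * N"
      unfolding N_def sum_distrib_left by (intro sum_mono) auto
    with p_sum[OF B(1), of "\<lambda>b. u b *\<^sub>R b"] G0 show ?thesis
      by (simp add: u algebra_simps)
  qed
  moreover have "0 < M * N + 1" using M(1) by (simp add: N_def sum_nonneg add_nonneg_pos)
  ultimately show ?thesis by blast
qed

text \<open>
  Subadditivity turns an upper bound by a multiple of the norm into a Lipschitz estimate.
\<close>
lemma sublinear_continuous:
  fixes B :: "'a::real_normed_vector set" and p :: "'a \<Rightarrow> real"
  assumes B: "finite B" "independent B" "span B = UNIV" and p: "sublinear p"
  shows "continuous_on UNIV p"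
proof -
  have "\<exists>C>0. \<forall>x. p x \<le> C * norm x"
    by (rule positive_homogeneous_dominates_sublinear[OF B _ _ _ p])
      (simp_all add: continuous_on_norm_id)
  then obtain C where C: "0 < C" "\<And>x. p x \<le> C * norm x" by blast
  have half: "p x - p y \<le> C * norm (x - y)" for x y
    using C(2)[of "x - y"] sublinear_add[OF p, of "x - y" y] by simp
  have "C-lipschitz_on UNIV p"
  proof (rule lipschitz_onI)
    show "dist (p x) (p y) \<le> C * dist x y" for x y
      using half[of x y] half[of y x] by (simp add: dist_norm norm_minus_commute)
  qed (use C(1) in simp)
  then show ?thesis by (rule lipschitz_on_continuous_on)
qed

lemma gauge_sublinear: "is_gauge \<gamma> \<Longrightarrow> sublinear \<gamma>"
  by (simp add: is_gauge_def sublinear_def)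

lemma gauge_nonneg: "is_gauge \<gamma> \<Longrightarrow> 0 \<le> \<gamma> x"
  by (simp add: is_gauge_def)

text \<open>
  For the forward direction the set of admissible factors has to be nonempty, since the
  infimum of the empty set of reals is an unspecified number; then factors arbitrarily close to \<open>1\<close>
  are admissible.
\<close>
lemma polar_gauge_le_1_iff:
  fixes B :: "'a::real_normed_vector set" and \<gamma> :: "'a \<Rightarrow> real"
  assumes B: "finite B" "independent B" "span B = UNIV" and \<gamma>: "is_gauge \<gamma>" and \<phi>: "linear \<phi>"
  shows "polar_gauge \<gamma> \<phi> \<le> 1 \<longleftrightarrow> (\<forall>x. \<phi> x \<le> \<gamma> x)"
proof
  let ?S = "{c. 0 < c \<and> (\<forall>x. \<phi> x \<le> c * \<gamma> x)}"
  assume le: "polar_gauge \<gamma> \<phi> \<le> 1"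
  have "0 < \<gamma> x" if "x \<noteq> 0" for x
    using \<gamma> that by (metis is_gauge_def less_eq_real_def)
  moreover have "sublinear \<phi>"
    using \<phi> by (simp add: sublinear_def linear_add linear_cmul)
  ultimately have "\<exists>C>0. \<forall>x. \<phi> x \<le> C * \<gamma> x"
    using sublinear_continuous[OF B gauge_sublinear[OF \<gamma>]] sublinear_scale[OF gauge_sublinear[OF \<gamma>]]
    by (intro positive_homogeneous_dominates_sublinear[OF B])
  then have ne: "?S \<noteq> {}" by auto
  show "\<forall>x. \<phi> x \<le> \<gamma> x"
  proof (rule allI, rule field_le_epsilon)
    fix x and e :: real assume e: "0 < e"
    define d where "d = e / (1 + \<gamma> x)"
    have "0 \<le> \<gamma> x" using \<gamma> by (rule gauge_nonneg)
    with e have d: "0 < d" "d * (1 + \<gamma> x) = e" by (simp_all add: d_def)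
    from le d(1) have "Inf ?S < 1 + d" by (simp add: polar_gauge_def)
    then obtain c where "c \<in> ?S" "c < 1 + d" using cInf_lessD[OF ne] by blast
    then have "\<phi> x \<le> c * \<gamma> x" "c * \<gamma> x \<le> (1 + d) * \<gamma> x"
      using \<open>0 \<le> \<gamma> x\<close> by (auto intro: mult_right_mono)
    with d show "\<phi> x \<le> \<gamma> x + e" by (simp add: algebra_simps)
  qed
next
  assume "\<forall>x. \<phi> x \<le> \<gamma> x"
  then show "polar_gauge \<gamma> \<phi> \<le> 1"
    unfolding polar_gauge_def by (intro cInf_lower bdd_belowI[where m = 0]) auto
qed

section \<open>Distance functions\<close>

lemma gauge_dist_le: "is_gauge \<gamma> \<Longrightarrow> y \<in> K \<Longrightarrow> gauge_dist \<gamma> x K \<le> \<gamma> (y - x)"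
  unfolding gauge_dist_def
  by (intro cINF_lower bdd_belowI2[where m = 0]) (auto simp: gauge_nonneg)

lemma gauge_dist_greatest:
  "K \<noteq> {} \<Longrightarrow> (\<And>y. y \<in> K \<Longrightarrow> m \<le> \<gamma> (y - x)) \<Longrightarrow> m \<le> gauge_dist \<gamma> x K"
  unfolding gauge_dist_def by (rule cINF_greatest)

lemma gauge_dist_nonneg: "is_gauge \<gamma> \<Longrightarrow> K \<noteq> {} \<Longrightarrow> 0 \<le> gauge_dist \<gamma> x K"
  by (rule gauge_dist_greatest) (simp_all add: gauge_nonneg)

lemma gauge_dist_eq_0:
  assumes "is_gauge \<gamma>" "x \<in> K"
  shows "gauge_dist \<gamma> x K = 0"
  using gauge_dist_le[OF assms, of x] gauge_dist_nonneg[OF assms(1), of K x] assms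
    sublinear_zero[OF gauge_sublinear[OF assms(1)]] by auto

lemma gauge_dist_approx:
  assumes "K \<noteq> {}" "0 < e"
  shows "\<exists>y\<in>K. \<gamma> (y - x) < gauge_dist \<gamma> x K + e"
proof (rule ccontr)
  assume "\<not> ?thesis"
  then have "gauge_dist \<gamma> x K + e \<le> gauge_dist \<gamma> x K"
    by (intro gauge_dist_greatest assms) (simp add: not_less)
  with assms show False by simp
qed

text \<open>
  Convex combinations of nearly optimal points of \<open>K\<close> are admissible competitors.
\<close>
lemma convex_gauge_dist:
  assumes \<gamma>: "is_gauge \<gamma>" and K: "K \<noteq> {}" "convex K"
  shows "convex_on UNIV (\<lambda>x. gauge_dist \<gamma> x K)"
proof (rule convex_onI)
  fix t x y assume t: "0 < t" "t < (1::real)"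
  show "gauge_dist \<gamma> ((1 - t) *\<^sub>R x + t *\<^sub>R y) K
      \<le> (1 - t) * gauge_dist \<gamma> x K + t * gauge_dist \<gamma> y K"
  proof (rule field_le_epsilon)
    fix e :: real assume e: "0 < e"
    obtain a where a: "a \<in> K" "\<gamma> (a - x) < gauge_dist \<gamma> x K + e"
      using gauge_dist_approx[OF K(1) e] by blast
    obtain b where b: "b \<in> K" "\<gamma> (b - y) < gauge_dist \<gamma> y K + e"
      using gauge_dist_approx[OF K(1) e] by blast
    have "(1 - t) *\<^sub>R a + t *\<^sub>R b \<in> K" using convexD[OF K(2) a(1) b(1), of "1 - t" t] t by simp
    moreover have "(1 - t) *\<^sub>R a + t *\<^sub>R b - ((1 - t) *\<^sub>R x + t *\<^sub>R y)
        = (1 - t) *\<^sub>R (a - x) + t *\<^sub>R (b - y)"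
      by (simp add: scaleR_diff_right)
    ultimately have "gauge_dist \<gamma> ((1 - t) *\<^sub>R x + t *\<^sub>R y) K
        \<le> \<gamma> ((1 - t) *\<^sub>R (a - x) + t *\<^sub>R (b - y))"
      using gauge_dist_le[OF \<gamma>] by metis
    also have "\<dots> \<le> (1 - t) * \<gamma> (a - x) + t * \<gamma> (b - y)"
      using sublinear_add[OF gauge_sublinear[OF \<gamma>], of "(1 - t) *\<^sub>R (a - x)" "t *\<^sub>R (b - y)"]
        sublinear_scale[OF gauge_sublinear[OF \<gamma>]] t by simp
    also have "\<dots> \<le> (1 - t) * (gauge_dist \<gamma> x K + e) + t * (gauge_dist \<gamma> y K + e)"
      using a b t by (intro add_mono mult_left_mono) auto
    finally show "gauge_dist \<gamma> ((1 - t) *\<^sub>R x + t *\<^sub>R y) K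
      \<le> (1 - t) * gauge_dist \<gamma> x K + t * gauge_dist \<gamma> y K + e"
      by (simp add: algebra_simps)
  qed
qed simp

text \<open>
  A subgradient \<open>\<phi>\<close> at \<open>a\<close>, tested at \<open>a - z\<close>, gives \<open>- \<phi> z \<le> \<gamma> z\<close>, since the distance increases
  by at most \<open>\<gamma> z\<close> when \<open>a\<close> is moved by \<open>- z\<close>; tested at points of \<open>K\<close>, where the distance is \<open>0\<close>, it
  bounds \<open>\<phi> (a - y)\<close> below by the distance. The bound by \<open>\<gamma>\<close> shows that this lower bound is the
  infimum. For the converse, \<open>\<phi> (x - a) = - \<phi> (y - x) - \<phi> (a - y)\<close> for every \<open>y \<in> K\<close>, where the
  first term is at most \<open>\<gamma> (y - x)\<close> and the second at most minus the distance of \<open>a\<close>.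
\<close>
lemma subgradient_gauge_dist_iff:
  fixes \<phi> :: "'a::real_vector \<Rightarrow> real"
  assumes \<gamma>: "is_gauge \<gamma>" and K: "K \<noteq> {}" and \<phi>: "linear \<phi>"
  shows "(\<forall>x. gauge_dist \<gamma> a K + \<phi> (x - a) \<le> gauge_dist \<gamma> x K) \<longleftrightarrow>
    (\<forall>x. - \<phi> x \<le> \<gamma> x) \<and> ereal (gauge_dist \<gamma> a K) = (INF y\<in>K. ereal (\<phi> (a - y)))"
    (is "?S \<longleftrightarrow> ?P \<and> ?E")
proof (intro iffI conjI)
  assume S: ?S
  show P: ?P
  proof
    fix z
    have "gauge_dist \<gamma> (a - z) K - \<gamma> z \<le> gauge_dist \<gamma> a K"
    proof (rule gauge_dist_greatest[OF K])
      fix y assume "y \<in> K"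
      then show "gauge_dist \<gamma> (a - z) K - \<gamma> z \<le> \<gamma> (y - a)"
        using gauge_dist_le[OF \<gamma>, of y K "a - z"] sublinear_add[OF gauge_sublinear[OF \<gamma>], of "y - a" z]
        by (simp add: algebra_simps)
    qed
    with S[rule_format, of "a - z"] linear_neg[OF \<phi>, of z] show "- \<phi> z \<le> \<gamma> z" by simp
  qed
  show ?E
  proof (rule antisym)
    show "ereal (gauge_dist \<gamma> a K) \<le> (INF y\<in>K. ereal (\<phi> (a - y)))"
    proof (rule INF_greatest)
      fix y assume "y \<in> K"
      with S[rule_format, of y] gauge_dist_eq_0[OF \<gamma>] linear_neg[OF \<phi>, of "a - y"]
      show "ereal (gauge_dist \<gamma> a K) \<le> ereal (\<phi> (a - y))" by simp
    qed
    show "(INF y\<in>K. ereal (\<phi> (a - y))) \<le> ereal (gauge_dist \<gamma> a K)"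
    proof (rule ereal_le_epsilon2)
      fix e :: real assume "0 < e"
      then obtain y where y: "y \<in> K" "\<gamma> (y - a) < gauge_dist \<gamma> a K + e"
        using gauge_dist_approx[OF K] by blast
      have "(INF y\<in>K. ereal (\<phi> (a - y))) \<le> ereal (\<phi> (a - y))" using y(1) by (rule INF_lower)
      also have "\<dots> \<le> ereal (gauge_dist \<gamma> a K + e)"
        using P[rule_format, of "y - a"] linear_neg[OF \<phi>, of "y - a"] y(2) by simp
      finally show "(INF y\<in>K. ereal (\<phi> (a - y))) \<le> ereal (gauge_dist \<gamma> a K) + ereal e" by simp
    qed
  qed
next
  assume PE: "?P \<and> ?E"
  show ?S
  proof
    fix x
    show "gauge_dist \<gamma> a K + \<phi> (x - a) \<le> gauge_dist \<gamma> x K"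
    proof (rule gauge_dist_greatest[OF K])
      fix y assume "y \<in> K"
      then have "ereal (gauge_dist \<gamma> a K) \<le> ereal (\<phi> (a - y))"
        using PE by (auto intro: INF_lower)
      moreover have "\<phi> (a - y) + \<phi> (x - a) = - \<phi> (y - x)"
        by (simp add: linear_diff[OF \<phi>])
      ultimately show "gauge_dist \<gamma> a K + \<phi> (x - a) \<le> \<gamma> (y - x)"
        using PE by (smt (verit) ereal_less_eq(3))
    qed
  qed
qed

section \<open>Optimality conditions\<close>

lemma minimizer_dist_sum_objective_iff:
  assumes "a \<in> K 0"
  shows "(\<forall>x. dist_sum_objective n \<gamma> K a \<le> dist_sum_objective n \<gamma> K x) \<longleftrightarrow>
    (\<forall>x\<in>K 0. (\<Sum>i=1..n. gauge_dist (\<gamma> i) a (K i)) \<le> (\<Sum>i=1..n. gauge_dist (\<gamma> i) x (K i)))"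
  using assms unfolding dist_sum_objective_def convex_indicator_def by auto

theorem theorem4p2:
  fixes B :: "'a::real_normed_vector set"
    and K :: "nat \<Rightarrow> 'a set"
    and \<gamma> :: "nat \<Rightarrow> 'a \<Rightarrow> real"
    and n :: nat
    and xbar :: 'a
  assumes "finite_dimensional_vector_space (scaleR :: real \<Rightarrow> 'a \<Rightarrow> 'a) B"
    and "\<And>i. i \<le> n \<Longrightarrow> K i \<noteq> {} \<and> closed (K i) \<and> convex (K i)"
    and "\<And>i. 1 \<le> i \<Longrightarrow> i \<le> n \<Longrightarrow> is_gauge (\<gamma> i)"
    and "xbar \<in> K 0"
  shows "(\<forall>x. dist_sum_objective n \<gamma> K xbar \<le> dist_sum_objective n \<gamma> K x) \<longleftrightarrow>
    (\<exists>\<phi> :: nat \<Rightarrow> 'a \<Rightarrow> real.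
       \<phi> 0 \<in> normal_cone xbar (K 0) \<and>
       (\<forall>i\<in>{1..n}. linear (\<phi> i) \<and>
          polar_gauge (\<gamma> i) (\<lambda>x. - \<phi> i x) \<le> 1 \<and>
          ereal (gauge_dist (\<gamma> i) xbar (K i)) = (INF y\<in>K i. ereal (\<phi> i (xbar - y)))) \<and>
       (\<forall>x. (\<Sum>i=0..n. \<phi> i x) = 0))"
    (is "?min \<longleftrightarrow> (\<exists>\<phi>. ?cert \<phi>)")
proof -
  let ?d = "\<lambda>i x. gauge_dist (\<gamma> i) x (K i)"
  have B: "finite B" "independent B" "span B = UNIV"
    using finite_dimensional_vector_space.finite_Basis[OF assms(1)]
      finite_dimensional_vector_space.independent_Basis[OF assms(1)]
      finite_dimensional_vector_space.span_Basis[OF assms(1)]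
    by (simp_all add: dependent_raw_def span_raw_def)
  have K: "K i \<noteq> {}" "convex (K i)" if "i \<le> n" for i using assms(2) that by auto
  have subgrad: "(\<forall>x. ?d i xbar + \<psi> (x - xbar) \<le> ?d i x) \<longleftrightarrow>
      polar_gauge (\<gamma> i) (\<lambda>x. - \<psi> x) \<le> 1 \<and> ereal (?d i xbar) = (INF y\<in>K i. ereal (\<psi> (xbar - y)))"
    if "i \<in> {1..n}" "linear \<psi>" for i \<psi>
    using subgradient_gauge_dist_iff[of "\<gamma> i" "K i" \<psi> xbar] assms(3)[of i] K(1)[of i] that
      polar_gauge_le_1_iff[OF B, of "\<gamma> i" "\<lambda>x. - \<psi> x"] linear_compose_neg[of \<psi>] by auto
  have split: "(\<Sum>i=0..n. \<phi> i x) = \<phi> 0 x + (\<Sum>i=1..n. \<phi> i x)" for \<phi> :: "nat \<Rightarrow> 'a \<Rightarrow> real" and x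
    by (simp add: sum.atLeast_Suc_atMost)
  show ?thesis
    unfolding minimizer_dist_sum_objective_iff[of xbar K n \<gamma>, OF assms(4)]
  proof
    assume "\<forall>x\<in>K 0. (\<Sum>i=1..n. ?d i xbar) \<le> (\<Sum>i=1..n. ?d i x)"
    moreover have "convex_on UNIV (?d i)" if "i \<in> {1..n}" for i
      using that assms(3) K by (intro convex_gauge_dist) auto
    ultimately have "\<exists>\<phi>. (\<forall>i\<in>{1..n}. linear (\<phi> i) \<and> (\<forall>x. ?d i xbar + \<phi> i (x - xbar) \<le> ?d i x)) \<and>
        (\<forall>x\<in>K 0. 0 \<le> (\<Sum>i=1..n. \<phi> i (x - xbar)))"
      using K(2)[of 0] assms(4) by (intro convex_sum_subgradients[OF B(1,3)]) auto
    then obtain \<phi> where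
      \<phi>: "\<And>i. i \<in> {1..n} \<Longrightarrow> linear (\<phi> i)"
        "\<And>i. i \<in> {1..n} \<Longrightarrow> \<forall>x. ?d i xbar + \<phi> i (x - xbar) \<le> ?d i x"
        "\<And>x. x \<in> K 0 \<Longrightarrow> 0 \<le> (\<Sum>i=1..n. \<phi> i (x - xbar))"
      by blast
    define \<psi> where "\<psi> = \<phi>(0 := \<lambda>x. - (\<Sum>i=1..n. \<phi> i x))"
    have "linear (\<lambda>x. - (\<Sum>i=1..n. \<phi> i x))"
      using \<phi>(1) by (intro linear_compose_neg linear_compose_sum) auto
    then have "\<psi> 0 \<in> normal_cone xbar (K 0)"
      using \<phi>(3) by (simp add: \<psi>_def normal_cone_def)
    moreover have "(\<Sum>i=0..n. \<psi> i x) = 0" for x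
    proof -
      have "(\<Sum>i=1..n. \<psi> i x) = (\<Sum>i=1..n. \<phi> i x)"
        by (intro sum.cong) (auto simp: \<psi>_def)
      then show ?thesis unfolding split by (simp add: \<psi>_def)
    qed
    moreover have "\<psi> i = \<phi> i" if "i \<in> {1..n}" for i using that by (simp add: \<psi>_def)
    ultimately have "?cert \<psi>" using \<phi>(1,2) subgrad by simp
    then show "\<exists>\<phi>. ?cert \<phi>" by (rule exI[where x = \<psi>])
  next
    assume "\<exists>\<phi>. ?cert \<phi>"
    then obtain \<phi> where \<phi>: "?cert \<phi>" ..
    show "\<forall>x\<in>K 0. (\<Sum>i=1..n. ?d i xbar) \<le> (\<Sum>i=1..n. ?d i x)"
    proof
      fix x assume "x \<in> K 0"
      with \<phi> have "\<phi> 0 (x - xbar) \<le> 0" by (simp add: normal_cone_def)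
      moreover have "\<phi> 0 (x - xbar) + (\<Sum>i=1..n. \<phi> i (x - xbar)) = 0"
        using \<phi> unfolding split by blast
      ultimately have "0 \<le> (\<Sum>i=1..n. \<phi> i (x - xbar))" by linarith
      then have "(\<Sum>i=1..n. ?d i xbar) \<le> (\<Sum>i=1..n. ?d i xbar + \<phi> i (x - xbar))"
        by (simp add: sum.distrib)
      also have "\<dots> \<le> (\<Sum>i=1..n. ?d i x)"
        using \<phi> subgrad by (intro sum_mono) blast
      finally show "(\<Sum>i=1..n. ?d i xbar) \<le> (\<Sum>i=1..n. ?d i x)" .
    qed
  qed
qed

end
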